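(* Fix a time domain $\mathbb{T}$ and a semantics $\psi$. For every algorithm $A=\langle\mathcal{S},\mathcal{S}_0,\iota,\varphi\rangle$ relative to $\psi$ over a finite vocabulary $\mathcal{V}$, there exists an equivalent $\psi$-abstract state machine $B$: namely there is an ASM program $\Pi$ over $\mathcal{V}$ such that $B=(\Pi,\mathcal{S},\mathcal{S}_0,\iota,\varphi)$ is a $\psi$-abstract state machine (same states, initial states, timeline map and trajectory map as $A$, and $\mathrm{gen}(\Pi,X)=\mathrm{gen}(X)$ for all $X\in\mathcal{S}$).
   Context: Time: a set $\mathbb{T}$ with an associative binary operation $+$ having a neutral element $0$, and a total order $\le$ preserved by $+$. A timeline is a subset of $\mathbb{T}$ containing $0$; $\mathbb{I}$ is the set of timelines. A moment $i$ of a timeline $I$ is discrete if there is $t\in I$, $i<t$, with no $t'\in I$ strictly between; then $i^+$ is the smallest element of $I$ above $i$; otherwise $i$ is continuous. $I$ is non-Zeno if each $i\in I$ has only finitely many discrete $j\le i$ in $I$. Truncation: $I[i]=\{t\mid i+t\in I\}$. A dynamical system $\langle\mathcal{S},\mathcal{S}_0,\iota,\varphi\rangle$: a nonempty class $\mathcal{S}$ of states, nonempty subclass $\mathcal{S}_0$ of initial states, $\iota:\mathcal{S}\to\mathbb{I}$ with non-Zeno values, and $\varphi(X,i)\in\mathcal{S}$ for $X\in\mathcal{S}$, $i\in\iota(X)$, with $\varphi(X,0)=X$, $\iota(\varphi(X,i))=\iota(X)[i]$, $\varphi(X,i+i')=\varphi(\varphi(X,i),i')$ for $i,i+i'\in\iota(X)$.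 An abstract transition system is a dynamical system whose states are first-order structures over a finite vocabulary $\mathcal{V}$ (containing the nullary symbol $\mathit{true}$) such that: states and initial states are closed under isomorphism; $\varphi(X,i)$ has the same base set as $X$; if $\zeta: X\cong Y$ then $\iota(X)=\iota(Y)$ and $\zeta:\varphi(X,i)\cong\varphi(Y,i)$ for all $i\in\iota(X)$. Locations $(f,\bar a)$, updates $(f,\bar a,b)$; for $X,Y$ on the same base set, $Y\setminus X$ is the set of updates $(f,\bar a,f^Y(\bar a))$ with $f^Y(\bar a)\ne f^X(\bar a)$. $X$ is a jump if $0$ is discrete in $\iota(X)$, a flow otherwise; for a jump, $\Delta^+(X)=\varphi(X,0^+)\setminus X$. A semantics $\psi$ over a class of sets is a partial function mapping functions from a timeline into a set $S$ of the class to elements of $S$. A function on a timeline is initially constant if constant on $[0,t]$ for some $t>0$. For a state $X$ and location $(f,\bar a)$, $\mathrm{Evolution}(X,(f,\bar a))$ is $t\mapsto f^{\varphi(X,t)}(\bar a)$ for $t\in\iota(X)$, $0\le t\le I_1$ for some $I_1\in\iota(X)$ ($I_1=0^+$ for a jump), and $\psi[X,f,\bar a]$ is its image under $\psi$. When defined for all locations, $\Delta_\psi(X)$ is the set of updates $(f,\bar a,\psi[X,f,\bar a])$ over locations whose evolution is not initially constant. The tagged generator is $\mathrm{gen}(X)=(\mathcal{F},\Delta_\psi(X))$ for a flow $X$ with $\Delta_\psi(X)$ defined and $(\mathcal{J},\Delta^+(X))$ for a jump $X$. An algorithm relative to $\psi$ (a $\psi$-definable algorithm) is an abstract transition system with a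 finite set $T$ of ground terms such that any two states agreeing on the values of all terms of $T$ both have tagged generators, and these are equal. ASM programs over $\mathcal{V}$ and $\mathrm{gen}(R,X)$: update rule $f(t_1,\dots,t_j):=t_0$ gives $(\mathcal{J},\{(f,(t_1^X,\dots,t_j^X),t_0^X)\})$; $\texttt{par } R_1\dots R_k\texttt{ endpar}$ (update rules $R_i$) gives $(\mathcal{J},\bigcup_i d_i)$ with $\mathrm{gen}(R_i,X)=(\mathcal{J},d_i)$; $\textsc{Dynamic}(f(t_1,\dots,t_j),t_0)$ gives $(\mathcal{F},\{(f,(t_1^X,\dots,t_j^X),t_0^X)\})$; $\texttt{flow } R_1\dots R_k\texttt{ endflow}$ (basic continuous rules) gives $(\mathcal{F},\bigcup_i d_i)$; $\texttt{if }\varphi\texttt{ then }R_1\texttt{ else }R_2\texttt{ endif}$ gives $\mathrm{gen}(R_1,X)$ if $\varphi^X=\mathit{true}^X$, else $\mathrm{gen}(R_2,X)$. A $\psi$-abstract state machine is a tuple $(\Pi,\mathcal{S},\mathcal{S}_0,\iota,\varphi)$ where $\Pi$ is an ASM program, $\mathcal{S}$ is a set of structures over a finite vocabulary closed under isomorphism, $\mathcal{S}_0\subseteq\mathcal{S}$ closed under isomorphism, and $\langle\mathcal{S},\mathcal{S}_0,\iota,\varphi\rangle$ is an algorithm relative to $\psi$ with $\mathrm{gen}(\Pi,X)=\mathrm{gen}(X)$ for all $X\in\mathcal{S}$.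
   Formalization: Added hypothesis: for isomorphic flow states ζ: X ≅ Y, ψ[Y,f,ζ(a)] = ζ(ψ[X,f,a]); without it the claim is false. Conditions are Boolean combinations of equations of ground terms, par/flow may be empty, and I_1 is any choice, positive where possible. *)

theory Defs
  imports Main
begin

section \<open>Time, timelines and dynamical systems\<close>

text \<open>Addition on time need not be commutative, so the order is required to be preserved on
  both sides. Neither is \<open>0\<close> required to be the least element.\<close>

class time_domain = monoid_add + linorder +
  assumes time_add_left_mono: "a \<le> b \<Longrightarrow> c + a \<le> c + b"
    and time_add_right_mono: "a \<le> b \<Longrightarrow> a + c \<le> b + c"

definition timeline :: "'t::time_domain set \<Rightarrow> bool" where
  "timeline I \<longleftrightarrow> 0 \<in> I"

definition discrete_moment :: "'t::time_domain set \<Rightarrow> 't \<Rightarrow> bool" where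
  "discrete_moment I i \<longleftrightarrow> (\<exists>t\<in>I. i < t \<and> \<not> (\<exists>t'\<in>I. i < t' \<and> t' < t))"

text \<open>The moment \<open>i\<^sup>+\<close>; it is meaningful only for discrete \<open>i\<close>.\<close>

definition next_moment :: "'t::time_domain set \<Rightarrow> 't \<Rightarrow> 't" where
  "next_moment I i = (LEAST t. t \<in> I \<and> i < t)"

definition non_Zeno :: "'t::time_domain set \<Rightarrow> bool" where
  "non_Zeno I \<longleftrightarrow> (\<forall>i\<in>I. finite {j \<in> I. j \<le> i \<and> discrete_moment I j})"

definition truncation :: "'t::time_domain set \<Rightarrow> 't \<Rightarrow> 't set" where
  "truncation I i = {t. i + t \<in> I}"

record ('s, 't) dyn_sys =
  states :: "'s set"
  initials :: "'s set"
  tline :: "'s \<Rightarrow> 't set"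
  traj :: "'s \<Rightarrow> 't \<Rightarrow> 's"

definition dynamical_system :: "('s, 't::time_domain) dyn_sys \<Rightarrow> bool" where
  "dynamical_system A \<longleftrightarrow>
     states A \<noteq> {} \<and> initials A \<noteq> {} \<and> initials A \<subseteq> states A \<and>
     (\<forall>X\<in>states A. timeline (tline A X) \<and> non_Zeno (tline A X)) \<and>
     (\<forall>X\<in>states A. \<forall>i\<in>tline A X. traj A X i \<in> states A) \<and>
     (\<forall>X\<in>states A. traj A X 0 = X) \<and>
     (\<forall>X\<in>states A. \<forall>i\<in>tline A X. tline A (traj A X i) = truncation (tline A X) i) \<and>
     (\<forall>X\<in>states A. \<forall>i i'. i \<in> tline A X \<and> i + i' \<in> tline A X \<longrightarrow>
        traj A X (i + i') = traj A (traj A X i) i')"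

definition jump :: "('s, 't::time_domain) dyn_sys \<Rightarrow> 's \<Rightarrow> bool" where
  "jump A X \<longleftrightarrow> discrete_moment (tline A X) 0"


section \<open>First-order structures and abstract transition systems\<close>

text \<open>Relations are given by their characteristic functions, so a vocabulary has function symbols
  only. The elements of all structures are drawn from one type \<open>'a\<close>, each structure having its own
  base set.\<close>

record 'f vocab =
  syms :: "'f set"
  arity :: "'f \<Rightarrow> nat"
  true_sym :: "'f"

definition vocabulary :: "'f vocab \<Rightarrow> bool" where
  "vocabulary V \<longleftrightarrow> finite (syms V) \<and> true_sym V \<in> syms V \<and> arity V (true_sym V) = 0"

datatype ('f, 'a) fo_struct = Struct (base: "'a set") (interp: "'f \<Rightarrow> 'a list \<Rightarrow> 'a")

type_synonym ('f, 'a) location = "'f \<times> 'a list"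

type_synonym ('f, 'a) update = "'f \<times> 'a list \<times> 'a"

definition locations :: "'f vocab \<Rightarrow> ('f, 'a) fo_struct \<Rightarrow> ('f, 'a) location set" where
  "locations V X = {(f, as). f \<in> syms V \<and> length as = arity V f \<and> set as \<subseteq> base X}"

text \<open>Outside its locations the interpretation of a structure is fixed to \<open>undefined\<close>, so that
  equality of HOL values is equality of structures.\<close>

definition is_structure :: "'f vocab \<Rightarrow> ('f, 'a) fo_struct \<Rightarrow> bool" where
  "is_structure V X \<longleftrightarrow>
     (\<forall>f as. (f, as) \<in> locations V X \<longrightarrow> interp X f as \<in> base X) \<and>
     (\<forall>f as. (f, as) \<notin> locations V X \<longrightarrow> interp X f as = undefined)"

definition struct_iso ::
    "'f vocab \<Rightarrow> ('a \<Rightarrow> 'a) \<Rightarrow> ('f, 'a) fo_struct \<Rightarrow> ('f, 'a) fo_struct \<Rightarrow> bool" where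
  "struct_iso V \<zeta> X Y \<longleftrightarrow>
     bij_betw \<zeta> (base X) (base Y) \<and>
     (\<forall>f as. (f, as) \<in> locations V X \<longrightarrow> \<zeta> (interp X f as) = interp Y f (map \<zeta> as))"

definition iso_closed :: "'f vocab \<Rightarrow> ('f, 'a) fo_struct set \<Rightarrow> bool" where
  "iso_closed V K \<longleftrightarrow> (\<forall>X\<in>K. \<forall>Y \<zeta>. is_structure V Y \<and> struct_iso V \<zeta> X Y \<longrightarrow> Y \<in> K)"

definition abstract_transition_system ::
    "'f vocab \<Rightarrow> (('f, 'a) fo_struct, 't::time_domain) dyn_sys \<Rightarrow> bool" where
  "abstract_transition_system V A \<longleftrightarrow>
     vocabulary V \<and> dynamical_system A \<and>
     (\<forall>X\<in>states A. is_structure V X) \<and>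
     iso_closed V (states A) \<and> iso_closed V (initials A) \<and>
     (\<forall>X\<in>states A. \<forall>i\<in>tline A X. base (traj A X i) = base X) \<and>
     (\<forall>X\<in>states A. \<forall>Y\<in>states A. \<forall>\<zeta>. struct_iso V \<zeta> X Y \<longrightarrow>
        tline A X = tline A Y \<and>
        (\<forall>i\<in>tline A X. struct_iso V \<zeta> (traj A X i) (traj A Y i)))"


section \<open>Semantics and tagged generators\<close>

text \<open>A function from a timeline into a set is a partial map whose domain is the timeline. Such a
  function comes with its codomain, which is therefore an argument of the semantics.\<close>

type_synonym ('t, 'a) semantics = "'a set \<Rightarrow> ('t \<rightharpoonup> 'a) \<Rightarrow> 'a option"

definition semantics_over :: "'a set set \<Rightarrow> ('t::time_domain, 'a) semantics \<Rightarrow> bool" where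
  "semantics_over C \<psi> \<longleftrightarrow>
     (\<forall>S e b. \<psi> S e = Some b \<longrightarrow> S \<in> C \<and> timeline (dom e) \<and> ran e \<subseteq> S \<and> b \<in> S)"

definition initially_constant :: "('t::time_domain \<rightharpoonup> 'a) \<Rightarrow> bool" where
  "initially_constant e \<longleftrightarrow> (\<exists>t\<in>dom e. 0 < t \<and> (\<forall>s\<in>dom e. 0 \<le> s \<and> s \<le> t \<longrightarrow> e s = e 0))"

text \<open>The endpoint \<open>I\<^sub>1\<close> of the initial evolution is left open apart from the conditions below, so
  it is given by a choice function \<open>h\<close> on states and locations. The endpoint \<open>0\<close> is
  allowed only if the timeline has no positive moment.\<close>

type_synonym ('f, 'a, 't) horizon = "('f, 'a) fo_struct \<Rightarrow> ('f, 'a) location \<Rightarrow> 't"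

definition horizon_for ::
    "'f vocab \<Rightarrow> (('f, 'a) fo_struct, 't::time_domain) dyn_sys \<Rightarrow> ('f, 'a, 't) horizon \<Rightarrow> bool" where
  "horizon_for V A h \<longleftrightarrow>
     (\<forall>X\<in>states A. \<forall>l\<in>locations V X.
        h X l \<in> tline A X \<and> 0 \<le> h X l \<and>
        ((\<exists>t\<in>tline A X. 0 < t) \<longrightarrow> 0 < h X l) \<and>
        (jump A X \<longrightarrow> h X l = next_moment (tline A X) 0))"

definition evolution ::
    "('f, 'a, 't) horizon \<Rightarrow> (('f, 'a) fo_struct, 't::time_domain) dyn_sys \<Rightarrow>
     ('f, 'a) fo_struct \<Rightarrow> ('f, 'a) location \<Rightarrow> 't \<rightharpoonup> 'a" where
  "evolution h A X l =
     (\<lambda>t. if t \<in> tline A X \<and> 0 \<le> t \<and> t \<le> h X l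
          then Some (interp (traj A X t) (fst l) (snd l)) else None)"

definition sem_value ::
    "('t, 'a) semantics \<Rightarrow> ('f, 'a, 't) horizon \<Rightarrow> (('f, 'a) fo_struct, 't::time_domain) dyn_sys \<Rightarrow>
     ('f, 'a) fo_struct \<Rightarrow> ('f, 'a) location \<Rightarrow> 'a option" where
  "sem_value \<psi> h A X l = \<psi> (base X) (evolution h A X l)"

definition state_diff ::
    "'f vocab \<Rightarrow> ('f, 'a) fo_struct \<Rightarrow> ('f, 'a) fo_struct \<Rightarrow> ('f, 'a) update set" where
  "state_diff V Y X =
     {(f, as, interp Y f as) | f as. (f, as) \<in> locations V X \<and> interp Y f as \<noteq> interp X f as}"

definition jump_delta ::
    "'f vocab \<Rightarrow> (('f, 'a) fo_struct, 't::time_domain) dyn_sys \<Rightarrow>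
     ('f, 'a) fo_struct \<Rightarrow> ('f, 'a) update set" where
  "jump_delta V A X = state_diff V (traj A X (next_moment (tline A X) 0)) X"

text \<open>The value \<open>None\<close> stands for an undefined update set.\<close>

definition flow_delta ::
    "'f vocab \<Rightarrow> ('t, 'a) semantics \<Rightarrow> ('f, 'a, 't) horizon \<Rightarrow>
     (('f, 'a) fo_struct, 't::time_domain) dyn_sys \<Rightarrow>
     ('f, 'a) fo_struct \<Rightarrow> ('f, 'a) update set option" where
  "flow_delta V \<psi> h A X =
     (if \<forall>l\<in>locations V X. sem_value \<psi> h A X l \<noteq> None
      then Some {(f, as, b) | f as b. (f, as) \<in> locations V X \<and>
              \<not> initially_constant (evolution h A X (f, as)) \<and>
              sem_value \<psi> h A X (f, as) = Some b}
      else None)"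

datatype tag = \<F> | \<J>

definition generator ::
    "'f vocab \<Rightarrow> ('t, 'a) semantics \<Rightarrow> ('f, 'a, 't) horizon \<Rightarrow>
     (('f, 'a) fo_struct, 't::time_domain) dyn_sys \<Rightarrow>
     ('f, 'a) fo_struct \<Rightarrow> (tag \<times> ('f, 'a) update set) option" where
  "generator V \<psi> h A X =
     (if jump A X then Some (\<J>, jump_delta V A X)
      else map_option (Pair \<F>) (flow_delta V \<psi> h A X))"

text \<open>On base sets an isomorphism is an arbitrary bijection, and a semantics over a class of sets
  need not commute with bijections (a derivative does not). Isomorphic states can therefore have
  semantic values that do not correspond to each other; the following condition excludes this. It
  is the counterpart for \<open>\<psi>[X, f, as]\<close> of the last condition on abstract transition systems, and
  concerns flow states only.\<close>

definition semantics_iso_invariant ::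
    "'f vocab \<Rightarrow> ('t, 'a) semantics \<Rightarrow> ('f, 'a, 't) horizon \<Rightarrow>
     (('f, 'a) fo_struct, 't::time_domain) dyn_sys \<Rightarrow> bool" where
  "semantics_iso_invariant V \<psi> h A \<longleftrightarrow>
     (\<forall>X\<in>states A. \<forall>Y\<in>states A. \<forall>\<zeta>. struct_iso V \<zeta> X Y \<and> \<not> jump A X \<longrightarrow>
        (\<forall>f as. (f, as) \<in> locations V X \<longrightarrow>
           sem_value \<psi> h A Y (f, map \<zeta> as) = map_option \<zeta> (sem_value \<psi> h A X (f, as))))"


section \<open>Algorithms\<close>

datatype 'f gterm = App 'f "'f gterm list"

fun wf_gterm :: "'f vocab \<Rightarrow> 'f gterm \<Rightarrow> bool" where
  "wf_gterm V (App f ts) \<longleftrightarrow>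
     f \<in> syms V \<and> length ts = arity V f \<and> (\<forall>t\<in>set ts. wf_gterm V t)"

fun gval :: "('f, 'a) fo_struct \<Rightarrow> 'f gterm \<Rightarrow> 'a" where
  "gval X (App f ts) = interp X f (map (gval X) ts)"

definition algorithm ::
    "'f vocab \<Rightarrow> ('t, 'a) semantics \<Rightarrow> ('f, 'a, 't) horizon \<Rightarrow>
     (('f, 'a) fo_struct, 't::time_domain) dyn_sys \<Rightarrow> bool" where
  "algorithm V \<psi> h A \<longleftrightarrow>
     abstract_transition_system V A \<and>
     (\<exists>T. finite T \<and> (\<forall>t\<in>T. wf_gterm V t) \<and>
        (\<forall>X\<in>states A. \<forall>Y\<in>states A. (\<forall>t\<in>T. gval X t = gval Y t) \<longrightarrow>
           generator V \<psi> h A X \<noteq> None \<and> generator V \<psi> h A Y \<noteq> None \<and>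
           generator V \<psi> h A X = generator V \<psi> h A Y))"


section \<open>ASM programs and abstract state machines\<close>

text \<open>A condition is a Boolean combination of ground terms, read as Boolean terms, and equations
  between ground terms. Equality and the connectives are logical symbols and not part of the
  vocabulary.\<close>

datatype 'f cond =
    Holds "'f gterm"
  | Eq "'f gterm" "'f gterm"
  | Neg "'f cond"
  | Conj "'f cond" "'f cond"
  | Disj "'f cond" "'f cond"

fun wf_cond :: "'f vocab \<Rightarrow> 'f cond \<Rightarrow> bool" where
  "wf_cond V (Holds t) \<longleftrightarrow> wf_gterm V t"
| "wf_cond V (Eq s t) \<longleftrightarrow> wf_gterm V s \<and> wf_gterm V t"
| "wf_cond V (Neg c) \<longleftrightarrow> wf_cond V c"
| "wf_cond V (Conj c d) \<longleftrightarrow> wf_cond V c \<and> wf_cond V d"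
| "wf_cond V (Disj c d) \<longleftrightarrow> wf_cond V c \<and> wf_cond V d"

fun cond_true :: "'f vocab \<Rightarrow> ('f, 'a) fo_struct \<Rightarrow> 'f cond \<Rightarrow> bool" where
  "cond_true V X (Holds t) \<longleftrightarrow> gval X t = interp X (true_sym V) []"
| "cond_true V X (Eq s t) \<longleftrightarrow> gval X s = gval X t"
| "cond_true V X (Neg c) \<longleftrightarrow> \<not> cond_true V X c"
| "cond_true V X (Conj c d) \<longleftrightarrow> cond_true V X c \<and> cond_true V X d"
| "cond_true V X (Disj c d) \<longleftrightarrow> cond_true V X c \<or> cond_true V X d"

text \<open>A triple \<open>(f, ts, t)\<close> stands for \<open>f(ts) := t\<close> in \<open>Update\<close> and \<open>Par\<close>, and for
  \<open>Dynamic(f(ts), t)\<close> in \<open>Dynamic\<close> and \<open>Flow\<close>. The lists of rules may be empty.\<close>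

type_synonym 'f assignment = "'f \<times> 'f gterm list \<times> 'f gterm"

datatype 'f program =
    Update "'f assignment"
  | Par "'f assignment list"
  | Dynamic "'f assignment"
  | Flow "'f assignment list"
  | Cond "'f cond" "'f program" "'f program"

definition wf_assignment :: "'f vocab \<Rightarrow> 'f assignment \<Rightarrow> bool" where
  "wf_assignment V r \<longleftrightarrow>
     (case r of (f, ts, t) \<Rightarrow>
        f \<in> syms V \<and> length ts = arity V f \<and> (\<forall>s\<in>set ts. wf_gterm V s) \<and> wf_gterm V t)"

fun wf_program :: "'f vocab \<Rightarrow> 'f program \<Rightarrow> bool" where
  "wf_program V (Update r) \<longleftrightarrow> wf_assignment V r"
| "wf_program V (Par rs) \<longleftrightarrow> (\<forall>r\<in>set rs. wf_assignment V r)"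
| "wf_program V (Dynamic r) \<longleftrightarrow> wf_assignment V r"
| "wf_program V (Flow rs) \<longleftrightarrow> (\<forall>r\<in>set rs. wf_assignment V r)"
| "wf_program V (Cond c R1 R2) \<longleftrightarrow> wf_cond V c \<and> wf_program V R1 \<and> wf_program V R2"

definition assignment_update :: "('f, 'a) fo_struct \<Rightarrow> 'f assignment \<Rightarrow> ('f, 'a) update" where
  "assignment_update X r = (case r of (f, ts, t) \<Rightarrow> (f, map (gval X) ts, gval X t))"

fun program_gen ::
    "'f vocab \<Rightarrow> 'f program \<Rightarrow> ('f, 'a) fo_struct \<Rightarrow> tag \<times> ('f, 'a) update set" where
  "program_gen V (Update r) X = (\<J>, {assignment_update X r})"
| "program_gen V (Par rs) X = (\<J>, \<Union>r\<in>set rs. {assignment_update X r})"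
| "program_gen V (Dynamic r) X = (\<F>, {assignment_update X r})"
| "program_gen V (Flow rs) X = (\<F>, \<Union>r\<in>set rs. {assignment_update X r})"
| "program_gen V (Cond c R1 R2) X =
     (if cond_true V X c then program_gen V R1 X else program_gen V R2 X)"

definition abstract_state_machine ::
    "'f vocab \<Rightarrow> ('t, 'a) semantics \<Rightarrow> ('f, 'a, 't) horizon \<Rightarrow>
     'f program \<times> (('f, 'a) fo_struct, 't::time_domain) dyn_sys \<Rightarrow> bool" where
  "abstract_state_machine V \<psi> h B \<longleftrightarrow>
     (case B of (\<Pi>, A) \<Rightarrow>
        wf_program V \<Pi> \<and>
        vocabulary V \<and> (\<forall>X\<in>states A. is_structure V X) \<and> iso_closed V (states A) \<and>
        initials A \<subseteq> states A \<and> iso_closed V (initials A) \<and>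
        algorithm V \<psi> h A \<and>
        (\<forall>X\<in>states A. generator V \<psi> h A X = Some (program_gen V \<Pi> X)))"

end

theory Submission
  imports Defs "HOL-Combinatorics.Transposition"
begin

text \<open>Let \<open>T\<close> be the finite set of terms witnessing that \<open>A\<close> is an algorithm. Every element
  occurring in an update of \<open>X\<close> is a value of a term of \<open>T\<close>: otherwise some isomorphic copy of
  \<open>X\<close> omits that element but keeps the values of \<open>T\<close>, hence has the same updates. So the updates
  of \<open>X\<close> are those of finitely many assignments with terms in \<open>T\<close>. If \<open>Y\<close> satisfies the same
  equations between terms of \<open>T\<close> as \<open>X\<close>, then an isomorphic copy of \<open>Y\<close> agrees with \<open>X\<close> on \<open>T\<close>, and
  the same assignments yield the updates of \<open>Y\<close>. There are only finitely many systems of equations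
  between terms of \<open>T\<close>, so a program can distinguish them by conditions.\<close>

section \<open>Injections\<close>

text \<open>Induction on \<open>F\<close>: swapping \<open>g a\<close> and \<open>f a\<close> after
  \<open>g\<close> corrects the value at the new point \<open>a\<close> and disturbs nothing on
  \<open>F\<close>, where \<open>g x = f x\<close> differs from both. The result is injective on the
  whole type, so it can be applied to any base set.\<close>

lemma inj_on_finite_extend:
  fixes f :: "'a \<Rightarrow> 'a"
  assumes "finite F" "inj_on f F"
  obtains g where "inj g" "\<And>x. x \<in> F \<Longrightarrow> g x = f x"
proof -
  have "\<exists>g. inj g \<and> (\<forall>x\<in>F. g x = f x)"
    using assms
  proof (induction F)
    case empty
    show ?case by (auto intro: inj_on_id)
  next
    case (insert a F)
    then obtain g where g: "inj g" "\<forall>x\<in>F. g x = f x" by auto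
    define g' where "g' = transpose (g a) (f a) \<circ> g"
    have "inj g'"
      unfolding g'_def using g(1) by (intro inj_compose) auto
    moreover have "g' x = f x" if "x \<in> insert a F" for x
    proof (cases "x = a")
      case True
      then show ?thesis by (simp add: g'_def)
    next
      case False
      with that have x: "x \<in> F" by simp
      with False insert.prems have "f x \<noteq> f a" by (auto simp: inj_on_def)
      moreover have "g x \<noteq> g a" using g(1) False by (auto dest: injD)
      ultimately show ?thesis using x g(2) by (simp add: g'_def transpose_def)
    qed
    ultimately show ?case by blast
  qed
  then show ?thesis using that by blast
qed

text \<open>Hilbert's hotel on the complement of \<open>F\<close>: an infinite set is in bijection
  with itself minus one point.\<close>

lemma inj_avoiding:
  assumes "infinite (UNIV :: 'a set)" "finite F" "(a :: 'a) \<notin> F"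
  obtains g where "inj g" "\<And>x. x \<in> F \<Longrightarrow> g x = x" "a \<notin> range g"
proof -
  have "infinite (UNIV - F)" using assms by auto
  then obtain k where k: "bij_betw k (UNIV - F) (UNIV - F - {a})"
    using infinite_imp_bij_betw[of "UNIV - F" a] by blast
  define g where "g x = (if x \<in> F then x else k x)" for x
  have kF: "k x \<notin> F" "k x \<noteq> a" if "x \<notin> F" for x
    using that bij_betwE[OF k] by auto
  have "inj g"
    using bij_betw_imp_inj_on[OF k] kF by (auto simp: inj_on_def g_def)
  moreover have "a \<notin> range g"
    using kF assms(3) by (auto simp: g_def)
  ultimately show ?thesis using that[of g] by (auto simp: g_def)
qed

section \<open>Isomorphic structures\<close>

text \<open>The copy of \<open>X\<close> transported along \<zeta>. The guard describes the
  locations of the copy; elsewhere the value must be \<open>undefined\<close> to satisfy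
  \<open>is_structure\<close>.\<close>

definition image_struct ::
    "'f vocab \<Rightarrow> ('a \<Rightarrow> 'a) \<Rightarrow> ('f, 'a) fo_struct \<Rightarrow> ('f, 'a) fo_struct" where
  "image_struct V \<zeta> X = Struct (\<zeta> ` base X)
     (\<lambda>f bs. if f \<in> syms V \<and> length bs = arity V f \<and> set bs \<subseteq> \<zeta> ` base X
             then \<zeta> (interp X f (map (inv_into (base X) \<zeta>) bs)) else undefined)"

lemma base_image_struct [simp]: "base (image_struct V \<zeta> X) = \<zeta> ` base X"
  by (simp add: image_struct_def)

lemma is_structure_image_struct:
  assumes "is_structure V X"
  shows "is_structure V (image_struct V \<zeta> X)"
proof -
  have "interp X f (map (inv_into (base X) \<zeta>) bs) \<in> base X"
    if "f \<in> syms V" "length bs = arity V f" "set bs \<subseteq> \<zeta> ` base X" for f bs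
  proof -
    have "(f, map (inv_into (base X) \<zeta>) bs) \<in> locations V X"
      using that by (auto simp: locations_def intro!: inv_into_into)
    then show ?thesis using assms by (simp add: is_structure_def)
  qed
  then show ?thesis by (auto simp: is_structure_def locations_def image_struct_def)
qed

lemma struct_iso_image_struct:
  assumes "inj_on \<zeta> (base X)"
  shows "struct_iso V \<zeta> X (image_struct V \<zeta> X)"
proof -
  have "map (inv_into (base X) \<zeta>) (map \<zeta> as) = as" if "set as \<subseteq> base X" for as
    using that assms by (induction as) auto
  then show ?thesis
    using assms by (auto simp: struct_iso_def bij_betw_def locations_def image_struct_def)
qed

lemma locations_struct_iso:
  assumes "struct_iso V \<zeta> X Y"
  shows "locations V Y = map_prod id (map \<zeta>) ` locations V X"
proof -
  have Y: "base Y = \<zeta> ` base X" using assms by (simp add: struct_iso_def bij_betw_def)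
  have "(f, bs) \<in> map_prod id (map \<zeta>) ` locations V X" if "(f, bs) \<in> locations V Y" for f bs
  proof -
    have "bs \<in> lists (\<zeta> ` base X)" using that Y by (auto simp: locations_def)
    then obtain as where "as \<in> lists (base X)" "bs = map \<zeta> as" by (auto simp: lists_image)
    then show ?thesis
      using that by (auto simp: locations_def intro!: image_eqI[where x = "(f, as)"])
  qed
  moreover have "map_prod id (map \<zeta>) l \<in> locations V Y" if "l \<in> locations V X" for l
    using that Y by (fastforce simp: locations_def)
  ultimately show ?thesis by auto
qed

lemma gval_in_base:
  assumes "is_structure V X" "wf_gterm V t"
  shows "gval X t \<in> base X"
  using assms(2)
proof (induction t)
  case (App f ts)
  then have "(f, map (gval X) ts) \<in> locations V X" by (auto simp: locations_def)
  then show ?case using assms(1) by (simp add: is_structure_def)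
qed

lemma gval_struct_iso:
  assumes "is_structure V X" "struct_iso V \<zeta> X Y" "wf_gterm V t"
  shows "gval Y t = \<zeta> (gval X t)"
  using assms(3)
proof (induction t)
  case (App f ts)
  have "(f, map (gval X) ts) \<in> locations V X"
    using App.prems gval_in_base[OF assms(1)] by (auto simp: locations_def)
  then have "\<zeta> (interp X f (map (gval X) ts)) = interp Y f (map \<zeta> (map (gval X) ts))"
    using assms(2) by (simp add: struct_iso_def)
  moreover have "map (gval Y) ts = map \<zeta> (map (gval X) ts)"
    using App by simp
  ultimately show ?case by (metis gval.simps)
qed

definition map_update :: "('a \<Rightarrow> 'a) \<Rightarrow> ('f, 'a) update \<Rightarrow> ('f, 'a) update" where
  "map_update \<zeta> = map_prod id (map_prod (map \<zeta>) \<zeta>)"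

lemma map_update_simp [simp]: "map_update \<zeta> (f, as, b) = (f, map \<zeta> as, \<zeta> b)"
  by (simp add: map_update_def)

text \<open>Allows \<zeta> to be cancelled from an equation between images of update sets.\<close>

lemma inj_map_update: "inj \<zeta> \<Longrightarrow> inj (map_update \<zeta>)"
  unfolding map_update_def by (intro prod.inj_map inj_on_id list.inj_map)

text \<open>The old and the new value at a location both lie in \<open>base X\<close>, where \<zeta>
  is injective, so a location changes exactly when its image does.\<close>

lemma state_diff_struct_iso:
  assumes "is_structure V X" "is_structure V X'" "base X' = base X"
    and iso: "struct_iso V \<zeta> X Y" "struct_iso V \<zeta> X' Y'"
  shows "state_diff V Y' Y = map_update \<zeta> ` state_diff V X' X"
proof -
  have loc: "locations V X' = locations V X" using assms(3) by (simp add: locations_def)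
  have inj: "inj_on \<zeta> (base X)" using iso(1) by (simp add: struct_iso_def bij_betw_def)
  have eq: "interp Y f (map \<zeta> as) = \<zeta> (interp X f as)"
           "interp Y' f (map \<zeta> as) = \<zeta> (interp X' f as)"
    if "(f, as) \<in> locations V X" for f as
    using iso that loc by (auto simp: struct_iso_def)
  have neq: "\<zeta> (interp X' f as) = \<zeta> (interp X f as) \<longleftrightarrow> interp X' f as = interp X f as"
    if "(f, as) \<in> locations V X" for f as
    using that inj assms(1-3) loc by (metis inj_on_eq_iff is_structure_def)
  have "state_diff V Y' Y =
      {(f, map \<zeta> as, interp Y' f (map \<zeta> as)) | f as.
         (f, as) \<in> locations V X \<and> interp Y' f (map \<zeta> as) \<noteq> interp Y f (map \<zeta> as)}"
    unfolding state_diff_def locations_struct_iso[OF iso(1)] by force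
  also have "\<dots> = {(f, map \<zeta> as, \<zeta> (interp X' f as)) | f as.
         (f, as) \<in> locations V X \<and> interp X' f as \<noteq> interp X f as}"
    using eq neq by force
  also have "\<dots> = map_update \<zeta> ` state_diff V X' X"
    unfolding state_diff_def loc by force
  finally show ?thesis .
qed

text \<open>The moment witnessing discreteness is itself the least one above \<open>i\<close>, so
  \<open>LEAST\<close> is attained although time need not be well-ordered.\<close>

lemma next_moment_in:
  assumes "discrete_moment I i"
  shows "next_moment I i \<in> I"
proof -
  obtain t where t: "t \<in> I" "i < t" "\<And>t'. t' \<in> I \<Longrightarrow> i < t' \<Longrightarrow> t \<le> t'"
    using assms unfolding discrete_moment_def by (meson not_le)
  then have "next_moment I i = t" unfolding next_moment_def by (intro Least_equality) auto
  with t show ?thesis by simp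
qed

section \<open>Updates of an algorithm\<close>

text \<open>Fixes one witness \<open>T\<close> from the definition of \<open>algorithm\<close>;
  \<open>gen_cong\<close> is the bounded exploration condition, in the style of Gurevich's postulate
  for sequential algorithms.\<close>

locale bounded_exploration =
  fixes V :: "'f vocab"
    and C :: "'a set set"
    and \<psi> :: "('t::time_domain, 'a) semantics"
    and h :: "('f, 'a, 't) horizon"
    and A :: "(('f, 'a) fo_struct, 't) dyn_sys"
    and T :: "'f gterm set"
  assumes universe: "infinite (UNIV :: 'a set)"
    and semantics: "semantics_over C \<psi>"
    and horizon: "horizon_for V A h"
    and ats: "abstract_transition_system V A"
    and invariant: "semantics_iso_invariant V \<psi> h A"
    and finite_T: "finite T"
    and wf_T: "t \<in> T \<Longrightarrow> wf_gterm V t"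
    and gen_cong: "\<lbrakk>X \<in> states A; Y \<in> states A; \<And>t. t \<in> T \<Longrightarrow> gval X t = gval Y t\<rbrakk>
      \<Longrightarrow> generator V \<psi> h A X \<noteq> None \<and> generator V \<psi> h A X = generator V \<psi> h A Y"
begin

lemma voc: "vocabulary V"
  and dyn: "dynamical_system A"
  using ats by (auto simp: abstract_transition_system_def)

lemma state_structure: "X \<in> states A \<Longrightarrow> is_structure V X"
  using ats by (simp add: abstract_transition_system_def)

lemma traj_state: "\<lbrakk>X \<in> states A; i \<in> tline A X\<rbrakk> \<Longrightarrow> traj A X i \<in> states A"
  using dyn by (simp add: dynamical_system_def)

lemma traj_base: "\<lbrakk>X \<in> states A; i \<in> tline A X\<rbrakk> \<Longrightarrow> base (traj A X i) = base X"
  using ats by (simp add: abstract_transition_system_def)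

lemma zero_traj: "X \<in> states A \<Longrightarrow> 0 \<in> tline A X \<and> traj A X 0 = X"
  using dyn by (simp add: dynamical_system_def timeline_def)

text \<open>Closure of the states under isomorphism makes every injection of the type yield a new
  state; all copies used below arise in this way.\<close>

lemma image_struct_state:
  assumes "X \<in> states A" "inj \<zeta>"
  shows "image_struct V \<zeta> X \<in> states A" "struct_iso V \<zeta> X (image_struct V \<zeta> X)"
proof -
  show iso: "struct_iso V \<zeta> X (image_struct V \<zeta> X)"
    using assms(2) by (intro struct_iso_image_struct) (auto intro: inj_on_subset)
  show "image_struct V \<zeta> X \<in> states A"
    using iso ats assms(1) is_structure_image_struct[OF state_structure[OF assms(1)]]
    unfolding abstract_transition_system_def iso_closed_def by blast
qed

section \<open>Transport of initial constancy and generators along isomorphisms\<close>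

lemma tline_iso:
  assumes "X \<in> states A" "Y \<in> states A" "struct_iso V \<zeta> X Y"
  shows "tline A Y = tline A X"
    and "i \<in> tline A X \<Longrightarrow> struct_iso V \<zeta> (traj A X i) (traj A Y i)"
  using ats assms unfolding abstract_transition_system_def by blast+

text \<open>In this form initial constancy does not depend on the horizon, which need not be the same at
  corresponding locations of isomorphic states.\<close>

lemma initially_constant_evolution:
  assumes X: "X \<in> states A" and l: "(f, as) \<in> locations V X"
  shows "initially_constant (evolution h A X (f, as)) \<longleftrightarrow>
    (\<exists>t\<in>tline A X. 0 < t \<and>
      (\<forall>s\<in>tline A X. 0 \<le> s \<and> s \<le> t \<longrightarrow> interp (traj A X s) f as = interp X f as))"
    (is "?L \<longleftrightarrow> ?R")
proof -
  let ?e = "evolution h A X (f, as)" and ?h = "h X (f, as)"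
  have h: "?h \<in> tline A X" "0 \<le> ?h" "\<And>t. t \<in> tline A X \<Longrightarrow> 0 < t \<Longrightarrow> 0 < ?h"
    using horizon X l unfolding horizon_for_def by blast+
  have dom: "t \<in> dom ?e \<longleftrightarrow> t \<in> tline A X \<and> 0 \<le> t \<and> t \<le> ?h" for t
    by (auto simp: evolution_def split: if_splits)
  have val: "?e t = Some (interp (traj A X t) f as)"
    if "t \<in> tline A X" "0 \<le> t" "t \<le> ?h" for t
    using that by (simp add: evolution_def)
  have zero: "?e 0 = Some (interp X f as)"
    using val[of 0] h zero_traj[OF X] by simp
  show ?thesis
  proof
    assume ?L
    then obtain t where t: "t \<in> dom ?e" "0 < t" "\<forall>s\<in>dom ?e. 0 \<le> s \<and> s \<le> t \<longrightarrow> ?e s = ?e 0"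
      unfolding initially_constant_def by blast
    have "interp (traj A X s) f as = interp X f as"
      if "s \<in> tline A X" "0 \<le> s" "s \<le> t" for s
    proof -
      have "s \<le> ?h" using that t(1) dom[of t] by auto
      with that t(3) dom[of s] val[of s] zero show ?thesis by auto
    qed
    with t(1,2) dom[of t] show ?R by blast
  next
    assume ?R
    then obtain t where t: "t \<in> tline A X" "0 < t"
      "\<forall>s\<in>tline A X. 0 \<le> s \<and> s \<le> t \<longrightarrow> interp (traj A X s) f as = interp X f as"
      by blast
    \<comment> \<open>The evolution may end before \<open>t\<close>, so the witness is cut off at
      the horizon. It stays positive because a positive moment in the timeline forces a positive
      horizon.\<close>
    define u where "u = min t ?h"
    have u: "0 < u" using t h(3) by (simp add: u_def)
    have "u \<in> tline A X" using t(1) h(1) by (simp add: u_def min_def)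
    then have "u \<in> dom ?e" using dom[of u] less_imp_le[OF u] by (simp add: u_def)
    moreover have "?e s = ?e 0" if "s \<in> dom ?e" "0 \<le> s" "s \<le> u" for s
      using that t(3) dom[of s] val[of s] zero by (simp add: u_def)
    ultimately show ?L unfolding initially_constant_def using u by blast
  qed
qed

text \<open>Isomorphic states share their timeline, and \<zeta> carries one trajectory to the other.
  All values compared lie in \<open>base X\<close>, so injectivity of \<zeta> there preserves and
  reflects constancy.\<close>

lemma initially_constant_iso:
  assumes XY: "X \<in> states A" "Y \<in> states A" and iso: "struct_iso V \<zeta> X Y"
    and l: "(f, as) \<in> locations V X"
  shows "initially_constant (evolution h A Y (f, map \<zeta> as)) \<longleftrightarrow>
    initially_constant (evolution h A X (f, as))"
proof -
  have lY: "(f, map \<zeta> as) \<in> locations V Y"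
    using l unfolding locations_struct_iso[OF iso] by force
  have "interp (traj A Y s) f (map \<zeta> as) = interp Y f (map \<zeta> as) \<longleftrightarrow>
      interp (traj A X s) f as = interp X f as" if s: "s \<in> tline A X" for s
  proof -
    have ls: "(f, as) \<in> locations V (traj A X s)"
      using l traj_base[OF XY(1) s] by (simp add: locations_def)
    have "interp (traj A Y s) f (map \<zeta> as) = \<zeta> (interp (traj A X s) f as)"
      using tline_iso(2)[OF XY iso s] ls by (simp add: struct_iso_def)
    moreover have "interp Y f (map \<zeta> as) = \<zeta> (interp X f as)"
      using iso l by (simp add: struct_iso_def)
    moreover have "interp X f as \<in> base X"
      using state_structure[OF XY(1)] l by (simp add: is_structure_def)
    moreover have "interp (traj A X s) f as \<in> base X"
      using state_structure[OF traj_state[OF XY(1) s]] ls traj_base[OF XY(1) s]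
      by (auto simp: is_structure_def)
    moreover have "inj_on \<zeta> (base X)" using iso by (simp add: struct_iso_def bij_betw_def)
    ultimately show ?thesis by (simp add: inj_on_eq_iff)
  qed
  then show ?thesis
    unfolding initially_constant_evolution[OF XY(1) l] initially_constant_evolution[OF XY(2) lY]
      tline_iso(1)[OF XY iso] by auto
qed

text \<open>Semantic values correspond by \<open>invariant\<close>, which also transfers
  definedness; the choice of non-constant locations corresponds by
  \<open>initially_constant_iso\<close>.\<close>

lemma flow_delta_iso:
  assumes XY: "X \<in> states A" "Y \<in> states A" and iso: "struct_iso V \<zeta> X Y"
    and flow: "\<not> jump A X"
  shows "flow_delta V \<psi> h A Y = map_option (image (map_update \<zeta>)) (flow_delta V \<psi> h A X)"
proof -
  have sem: "sem_value \<psi> h A Y (f, map \<zeta> as) = map_option \<zeta> (sem_value \<psi> h A X (f, as))"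
    if "(f, as) \<in> locations V X" for f as
    using invariant XY iso flow that unfolding semantics_iso_invariant_def by blast
  have defined: "(\<forall>l\<in>locations V Y. sem_value \<psi> h A Y l \<noteq> None) \<longleftrightarrow>
      (\<forall>l\<in>locations V X. sem_value \<psi> h A X l \<noteq> None)"
    unfolding locations_struct_iso[OF iso] using sem by force
  have "{(f, bs, c) | f bs c. (f, bs) \<in> locations V Y \<and>
            \<not> initially_constant (evolution h A Y (f, bs)) \<and>
            sem_value \<psi> h A Y (f, bs) = Some c} =
      {(f, map \<zeta> as, c) | f as c. (f, as) \<in> locations V X \<and>
            \<not> initially_constant (evolution h A Y (f, map \<zeta> as)) \<and>
            sem_value \<psi> h A Y (f, map \<zeta> as) = Some c}"
    unfolding locations_struct_iso[OF iso] by force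
  also have "\<dots> = {(f, map \<zeta> as, \<zeta> b) | f as b. (f, as) \<in> locations V X \<and>
            \<not> initially_constant (evolution h A X (f, as)) \<and>
            sem_value \<psi> h A X (f, as) = Some b}"
    using sem initially_constant_iso[OF XY iso] by force
  also have "\<dots> = map_update \<zeta> ` {(f, as, b) | f as b. (f, as) \<in> locations V X \<and>
            \<not> initially_constant (evolution h A X (f, as)) \<and>
            sem_value \<psi> h A X (f, as) = Some b}"
    by force
  finally show ?thesis unfolding flow_delta_def defined by simp
qed

lemma generator_iso:
  assumes XY: "X \<in> states A" "Y \<in> states A" and iso: "struct_iso V \<zeta> X Y"
  shows "generator V \<psi> h A Y =
    map_option (map_prod id (image (map_update \<zeta>))) (generator V \<psi> h A X)"
proof (cases "jump A X")
  case True
  let ?n = "next_moment (tline A X) 0"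
  have n: "?n \<in> tline A X" using True by (simp add: jump_def next_moment_in)
  have "jump_delta V A Y = map_update \<zeta> ` jump_delta V A X"
    unfolding jump_delta_def tline_iso(1)[OF XY iso]
    using XY n iso by (intro state_diff_struct_iso state_structure traj_state traj_base tline_iso(2))
  moreover have "jump A Y" using True tline_iso(1)[OF XY iso] by (simp add: jump_def)
  ultimately show ?thesis using True by (simp add: generator_def)
next
  case False
  moreover have "\<not> jump A Y" using False tline_iso(1)[OF XY iso] by (simp add: jump_def)
  ultimately show ?thesis
    by (simp add: generator_def flow_delta_iso[OF XY iso] option.map_comp comp_def)
qed

section \<open>Elements occurring in updates\<close>

lemma update_in_base:
  assumes X: "X \<in> states A" and gen: "generator V \<psi> h A X = Some (tg, U)"
    and u: "(f, as, b) \<in> U"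
  shows "(f, as) \<in> locations V X \<and> b \<in> base X"
proof (cases "jump A X")
  case True
  let ?n = "next_moment (tline A X) 0"
  have n: "?n \<in> tline A X" using True by (simp add: jump_def next_moment_in)
  have u': "(f, as) \<in> locations V X" "b = interp (traj A X ?n) f as"
    using True gen u by (auto simp: generator_def jump_delta_def state_diff_def)
  then have "b \<in> base (traj A X ?n)"
    using state_structure[OF traj_state[OF X n]] traj_base[OF X n]
    by (simp add: is_structure_def locations_def)
  with u' traj_base[OF X n] show ?thesis by simp
next
  case False
  then have "(f, as) \<in> locations V X" "sem_value \<psi> h A X (f, as) = Some b"
    using gen u by (auto simp: generator_def flow_delta_def split: if_splits)
  \<comment> \<open>A semantics over a class of sets takes its values in the given codomain, here
    \<open>base X\<close>.\<close>
  then show ?thesis using semantics by (auto simp: semantics_over_def sem_value_def)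
qed

lemma update_critical:
  assumes X: "X \<in> states A" and gen: "generator V \<psi> h A X = Some (tg, U)"
    and u: "(f, as, b) \<in> U"
  shows "insert b (set as) \<subseteq> gval X ` T"
proof
  fix a assume a: "a \<in> insert b (set as)"
  show "a \<in> gval X ` T"
  proof (rule ccontr)
    assume "a \<notin> gval X ` T"
    \<comment> \<open>The map fixes the finitely many values of \<open>T\<close> and omits
      \<open>a\<close>; its existence rests on the infinite universe.\<close>
    then obtain \<zeta> where \<zeta>: "inj \<zeta>" "\<And>x. x \<in> gval X ` T \<Longrightarrow> \<zeta> x = x" "a \<notin> range \<zeta>"
      using inj_avoiding[OF universe finite_imageI[OF finite_T]] by blast
    let ?Y = "image_struct V \<zeta> X"
    note Y = image_struct_state[OF X \<zeta>(1)]
    have "gval X t = gval ?Y t" if "t \<in> T" for t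
      using gval_struct_iso[OF state_structure[OF X] Y(2) wf_T[OF that]] \<zeta>(2) that by simp
    \<comment> \<open>The copy has literally the same update set, not merely its image under
      \<zeta>; hence \<open>a\<close> would have to lie in its base set, which is contained in the
      range of \<zeta>.\<close>
    then have "generator V \<psi> h A ?Y = Some (tg, U)"
      using gen_cong[OF X Y(1)] gen by simp
    from update_in_base[OF Y(1) this u] a have "a \<in> base ?Y"
      by (auto simp: locations_def)
    with \<zeta>(3) show False by auto
  qed
qed

section \<open>Construction of the program\<close>

text \<open>The kernel of \<open>gval X\<close> on \<open>T\<close>. Two states with the same kernel
  are T-similar in the terminology of sequential algorithms.\<close>

definition equations :: "('f, 'a) fo_struct \<Rightarrow> ('f gterm \<times> 'f gterm) set" where
  "equations X = {(s, t) \<in> T \<times> T. gval X s = gval X t}"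

text \<open>Sending \<open>gval Y t\<close> to \<open>gval X t\<close> is well defined and injective
  exactly because the equations agree. Extended to an injection of the type, it gives a copy of
  \<open>Y\<close> that agrees with \<open>X\<close> on \<open>T\<close>; \<open>gen_cong\<close>
  and \<open>generator_iso\<close> then relate the generators.\<close>

lemma generator_same_equations:
  assumes X: "X \<in> states A" and Y: "Y \<in> states A" and eq: "equations Y = equations X"
  obtains \<zeta> where "inj \<zeta>" "\<And>t. t \<in> T \<Longrightarrow> gval X t = \<zeta> (gval Y t)"
    "generator V \<psi> h A X = map_option (map_prod id (image (map_update \<zeta>))) (generator V \<psi> h A Y)"
proof -
  have eq': "gval X s = gval X t \<longleftrightarrow> gval Y s = gval Y t" if "s \<in> T" "t \<in> T" for s t
    using eq that by (auto simp: equations_def set_eq_iff)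
  \<comment> \<open>\<open>SOME\<close> picks any term denoting \<open>y\<close>; by
    \<open>eq'\<close> the value in \<open>X\<close> does not depend on the choice.\<close>
  define k where "k y = gval X (SOME t. t \<in> T \<and> gval Y t = y)" for y
  have k: "k (gval Y t) = gval X t" if "t \<in> T" for t
  proof -
    have "(SOME s. s \<in> T \<and> gval Y s = gval Y t) \<in> T \<and>
        gval Y (SOME s. s \<in> T \<and> gval Y s = gval Y t) = gval Y t"
      by (rule someI[where x = t]) (simp add: that)
    then show ?thesis using eq' that unfolding k_def by blast
  qed
  have "inj_on k (gval Y ` T)"
    using k eq' by (auto simp: inj_on_def)
  then obtain \<zeta> where \<zeta>: "inj \<zeta>" "\<And>y. y \<in> gval Y ` T \<Longrightarrow> \<zeta> y = k y"
    using inj_on_finite_extend[OF finite_imageI[OF finite_T]] by blast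
  let ?Z = "image_struct V \<zeta> Y"
  note Z = image_struct_state[OF Y \<zeta>(1)]
  have val: "gval X t = \<zeta> (gval Y t)" if "t \<in> T" for t
    using \<zeta>(2) k that by simp
  then have "gval X t = gval ?Z t" if "t \<in> T" for t
    using gval_struct_iso[OF state_structure[OF Y] Z(2) wf_T[OF that]] that by simp
  then have "generator V \<psi> h A X = generator V \<psi> h A ?Z"
    using gen_cong[OF X Z(1)] by blast
  with generator_iso[OF Y Z] have
    "generator V \<psi> h A X = map_option (map_prod id (image (map_update \<zeta>))) (generator V \<psi> h A Y)"
    by simp
  with \<zeta>(1) val show ?thesis using that by blast
qed

section \<open>Syntactic form of the updates\<close>

definition critical_assignments :: "'f assignment set" where
  "critical_assignments =
     {(f, ts, t). f \<in> syms V \<and> length ts = arity V f \<and> set ts \<subseteq> T \<and> t \<in> T}"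

lemma finite_critical_assignments: "finite critical_assignments"
proof -
  have "critical_assignments \<subseteq>
      (\<Union>f\<in>syms V. {f} \<times> {ts. set ts \<subseteq> T \<and> length ts = arity V f} \<times> T)"
    by (auto simp: critical_assignments_def)
  moreover have "finite (syms V)" using voc by (simp add: vocabulary_def)
  ultimately show ?thesis
    using finite_T
    by (elim finite_subset) (intro finite_UN_I finite_cartesian_product finite_lists_length_eq, auto)
qed

lemma wf_critical_assignment: "r \<in> critical_assignments \<Longrightarrow> wf_assignment V r"
  using wf_T by (auto simp: critical_assignments_def wf_assignment_def)

lemma updates_by_assignments:
  assumes X: "X \<in> states A" and gen: "generator V \<psi> h A X = Some (tg, U)"
  obtains R where "R \<subseteq> critical_assignments" "U = assignment_update X ` R"
proof -
  \<comment> \<open>The largest candidate; its evaluation lies in \<open>U\<close> by definition,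
    and only the converse inclusion requires \<open>update_critical\<close>.\<close>
  let ?R = "{r \<in> critical_assignments. assignment_update X r \<in> U}"
  have "u \<in> assignment_update X ` ?R" if "u \<in> U" for u
  proof -
    obtain f as b where u: "u = (f, as, b)" by (cases u)
    with that have crit: "insert b (set as) \<subseteq> gval X ` T"
      using update_critical[OF X gen] by simp
    then have "as \<in> lists (gval X ` T)" by auto
    then obtain ts where ts: "ts \<in> lists T" "as = map (gval X) ts" by (auto simp: lists_image)
    obtain t where t: "t \<in> T" "b = gval X t" using crit by auto
    have "(f, as) \<in> locations V X" using update_in_base[OF X gen] that u by blast
    with ts t have "(f, ts, t) \<in> critical_assignments"
      by (auto simp: critical_assignments_def locations_def)
    moreover have "assignment_update X (f, ts, t) = u"
      using u ts t by (simp add: assignment_update_def)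
    ultimately show ?thesis using that by force
  qed
  then have "U = assignment_update X ` ?R" by blast
  then show ?thesis by (intro that[of ?R]) auto
qed

text \<open>The assignments are read off at the single state \<open>X\<close>. At a state
  \<open>Y\<close> with the same equations their values differ only by \<zeta>, as do the update
  sets.\<close>

lemma program_for_equations:
  assumes X: "X \<in> states A"
  obtains P where "wf_program V P"
    "\<And>Y. Y \<in> states A \<Longrightarrow> equations Y = equations X \<Longrightarrow>
       generator V \<psi> h A Y = Some (program_gen V P Y)"
proof -
  \<comment> \<open>Comparing \<open>X\<close> with itself in \<open>gen_cong\<close> shows that its
    generator is defined.\<close>
  obtain tg U where gen: "generator V \<psi> h A X = Some (tg, U)"
    using gen_cong[OF X X] by auto
  obtain R where R: "R \<subseteq> critical_assignments" "U = assignment_update X ` R"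
    using updates_by_assignments[OF X gen] by blast
  obtain rs where rs: "set rs = R"
    using finite_list[OF finite_subset[OF R(1) finite_critical_assignments]] by blast
  define P where "P = (case tg of \<J> \<Rightarrow> Par rs | \<F> \<Rightarrow> Flow rs)"
  have genP: "program_gen V P Y = (tg, assignment_update Y ` R)" for Y :: "('f, 'a) fo_struct"
    using rs by (auto simp: P_def split: tag.split)
  have "wf_program V P"
    using R(1) rs wf_critical_assignment by (auto simp: P_def split: tag.split)
  moreover have "generator V \<psi> h A Y = Some (program_gen V P Y)"
    if Y: "Y \<in> states A" "equations Y = equations X" for Y
  proof -
    obtain \<zeta> where \<zeta>: "inj \<zeta>" "\<And>t. t \<in> T \<Longrightarrow> gval X t = \<zeta> (gval Y t)"
      "generator V \<psi> h A X = map_option (map_prod id (image (map_update \<zeta>))) (generator V \<psi> h A Y)"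
      using generator_same_equations[OF X Y] by blast
    \<comment> \<open>The transport acts on the update set only, so \<open>Y\<close> carries the
      same tag as \<open>X\<close>.\<close>
    obtain U' where U': "generator V \<psi> h A Y = Some (tg, U')" "U = map_update \<zeta> ` U'"
      using \<zeta>(3) gen by (cases "generator V \<psi> h A Y") auto
    have "assignment_update X r = map_update \<zeta> (assignment_update Y r)" if "r \<in> R" for r
    proof -
      obtain f ts t where "r = (f, ts, t)" by (cases r)
      moreover from this have "set ts \<subseteq> T" "t \<in> T"
        using that R(1) by (auto simp: critical_assignments_def)
      ultimately show ?thesis using \<zeta>(2) by (auto simp: assignment_update_def)
    qed
    then have "map_update \<zeta> ` U' = map_update \<zeta> ` assignment_update Y ` R"
      using R(2) U'(2) by (simp add: image_image)
    then have "U' = assignment_update Y ` R"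
      by (rule inj_image_eq_iff[OF inj_map_update[OF \<zeta>(1)], THEN iffD1])
    with U'(1) genP show ?thesis by simp
  qed
  ultimately show ?thesis using that by blast
qed

section \<open>Case distinction by conditions\<close>

lemma condition_for_equations:
  obtains c where "wf_cond V c"
    "\<And>X :: ('f, 'a) fo_struct. cond_true V X c \<longleftrightarrow> equations X = Q"
proof -
  \<comment> \<open>The condition is a finite conjunction, one equation or negated equation for each
    pair, built up over subsets \<open>S\<close> of \<open>T \<times> T\<close>.\<close>
  have "\<exists>c. wf_cond V c \<and> (\<forall>X :: ('f, 'a) fo_struct. cond_true V X c \<longleftrightarrow>
      (\<forall>(s, t)\<in>S. gval X s = gval X t \<longleftrightarrow> (s, t) \<in> Q))"
    if "finite S" "S \<subseteq> T \<times> T" for S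
    using that
  proof (induction S)
    case empty
    have "wf_cond V (Holds (App (true_sym V) []))"
      using voc by (simp add: vocabulary_def)
    then show ?case by (intro exI[of _ "Holds (App (true_sym V) [])"]) simp
  next
    case (insert p S)
    obtain s t where p: "p = (s, t)" by (cases p)
    from insert obtain c where c: "wf_cond V c"
      "\<forall>X :: ('f, 'a) fo_struct. cond_true V X c \<longleftrightarrow>
        (\<forall>(s, t)\<in>S. gval X s = gval X t \<longleftrightarrow> (s, t) \<in> Q)" by auto
    let ?d = "if p \<in> Q then Eq s t else Neg (Eq s t)"
    have "wf_cond V (Conj ?d c)" using c(1) p insert.prems wf_T by auto
    then show ?case using c(2) p by (intro exI[of _ "Conj ?d c"]) auto
  qed
  from this[of "T \<times> T"] finite_T obtain c where c: "wf_cond V c"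
    "\<And>X :: ('f, 'a) fo_struct. cond_true V X c \<longleftrightarrow>
      (\<forall>(s, t)\<in>T \<times> T. gval X s = gval X t \<longleftrightarrow> (s, t) \<in> Q)" by auto
  show ?thesis
  proof (cases "Q \<subseteq> T \<times> T")
    case True
    then have "cond_true V X c \<longleftrightarrow> equations X = Q" for X :: "('f, 'a) fo_struct"
      unfolding c(2) equations_def by auto
    with c(1) show ?thesis using that by blast
  next
    case False
    \<comment> \<open>No structure has a \<open>Q\<close> reaching outside
      \<open>T \<times> T\<close> as its equations, so a contradictory condition serves.\<close>
    let ?true = "Holds (App (true_sym V) [])"
    have "wf_cond V (Neg ?true)" using voc by (simp add: vocabulary_def)
    moreover have "cond_true V X (Neg ?true) \<longleftrightarrow> equations X = Q" for X :: "('f, 'a) fo_struct"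
      using False by (auto simp: equations_def)
    ultimately show ?thesis using that by blast
  qed
qed

text \<open>A cascade of conditionals over the finitely many equation sets realised by
  states.\<close>

lemma program_exists:
  obtains P where "wf_program V P"
    "\<And>X. X \<in> states A \<Longrightarrow> generator V \<psi> h A X = Some (program_gen V P X)"
proof -
  have "equations ` states A \<subseteq> Pow (T \<times> T)" by (auto simp: equations_def)
  then have "finite (equations ` states A)"
    using finite_T by (meson finite_Pow_iff finite_SigmaI finite_subset)
  moreover have "\<exists>P. wf_program V P \<and> (\<forall>X\<in>states A. equations X \<in> E \<longrightarrow>
      generator V \<psi> h A X = Some (program_gen V P X))"
    if "finite E" "E \<subseteq> equations ` states A" for E
    using that
  proof (induction E)
    case empty
    \<comment> \<open>With no equation set to serve, any well-formed program will do as the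
      innermost else branch.\<close>
    show ?case by (intro exI[of _ "Par []"]) simp
  next
    case (insert Q E)
    then obtain P where P: "wf_program V P" "\<forall>X\<in>states A. equations X \<in> E \<longrightarrow>
      generator V \<psi> h A X = Some (program_gen V P X)" by auto
    \<comment> \<open>Each \<open>Q\<close> in the induction is realised by some state, from which
      the branch for \<open>Q\<close> is constructed.\<close>
    obtain X where X: "X \<in> states A" "Q = equations X" using insert.prems by auto
    obtain P' where P': "wf_program V P'" "\<And>Y. Y \<in> states A \<Longrightarrow> equations Y = Q \<Longrightarrow>
      generator V \<psi> h A Y = Some (program_gen V P' Y)"
      using program_for_equations[OF X(1)] X(2) by blast
    obtain c where c: "wf_cond V c"
      "\<And>X :: ('f, 'a) fo_struct. cond_true V X c \<longleftrightarrow> equations X = Q"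
      using condition_for_equations[of Q] by blast
    show ?case using P P' c by (intro exI[of _ "Cond c P' P"]) auto
  qed
  ultimately obtain P where "wf_program V P" "\<forall>X\<in>states A. equations X \<in> equations ` states A \<longrightarrow>
      generator V \<psi> h A X = Some (program_gen V P X)"
    by (meson order_refl)
  then show ?thesis using that[of P] by simp
qed

end

theorem theorem2:
  fixes V :: "'f vocab"
    and C :: "'a set set"
    and \<psi> :: "('t::time_domain, 'a) semantics"
    and h :: "('f, 'a, 't) horizon"
    and A :: "(('f, 'a) fo_struct, 't) dyn_sys"
  assumes universe: "infinite (UNIV :: 'a set)"
    and semantics: "semantics_over C \<psi>"
    and voc: "vocabulary V"
    and horizon: "horizon_for V A h"
    and alg: "algorithm V \<psi> h A"
    and invariant: "semantics_iso_invariant V \<psi> h A"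
  shows "\<exists>\<Pi>. abstract_state_machine V \<psi> h (\<Pi>, A)"
proof -
  obtain T where ats: "abstract_transition_system V A" and T: "finite T" "\<forall>t\<in>T. wf_gterm V t"
    "\<forall>X\<in>states A. \<forall>Y\<in>states A. (\<forall>t\<in>T. gval X t = gval Y t) \<longrightarrow>
       generator V \<psi> h A X \<noteq> None \<and> generator V \<psi> h A Y \<noteq> None \<and>
       generator V \<psi> h A X = generator V \<psi> h A Y"
    using alg unfolding algorithm_def by blast
  interpret bounded_exploration V C \<psi> h A T
    by unfold_locales (use assms ats T in blast)+
  obtain P where "wf_program V P"
    "\<And>X. X \<in> states A \<Longrightarrow> generator V \<psi> h A X = Some (program_gen V P X)"
    using program_exists by blast
  then have "abstract_state_machine V \<psi> h (P, A)"
    using ats alg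
    by (simp add: abstract_state_machine_def abstract_transition_system_def dynamical_system_def)
  then show ?thesis by blast
qed

end
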